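(* Let $n\ge 2$ be an integer and let $\mathcal{F}_n(x)$ be a generalized Fibonacci polynomial of Fibonacci type determined by $d(x)$ and $g(x)$. For $j=1,2,\dots,n-1$ let $\gamma_j=2i\cos\frac{j\pi}{n}$, where $i=\sqrt{-1}$. If $r\in\mathbb{C}$ satisfies $g(r)\ne0$ and $d(r)/\sqrt{g(r)}=\gamma_j$ for some $j\in\{1,2,\dots,n-1\}$, then $r$ is a root of $\mathcal{F}_n(x)$.
   Context: Given nonzero polynomials $d(x),g(x)\in\mathbb{Q}[x]$ with $\deg d>\deg g$, the generalized Fibonacci polynomials of Fibonacci type are $\mathcal{F}_0(x)=0$, $\mathcal{F}_1(x)=1$, $\mathcal{F}_n(x)=d(x)\mathcal{F}_{n-1}(x)+g(x)\mathcal{F}_{n-2}(x)$ for $n\ge 2$. $\sqrt{g(r)}$ denotes a complex square root of $g(r)$. *)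

theory Defs
  imports Complex_Main "HOL-Computational_Algebra.Polynomial"
begin

text \<open>
  Generalized Fibonacci polynomials of Fibonacci type, indexed from 0. The standing
  conditions on \<open>d\<close> and \<open>g\<close> (both nonzero, degree of \<open>d\<close> above degree of \<open>g\<close>) are not
  built into the recursion; they are separate hypotheses wherever they are needed.
\<close>

fun fib_poly :: "rat poly \<Rightarrow> rat poly \<Rightarrow> nat \<Rightarrow> rat poly" where
  "fib_poly d g 0 = 0"
| "fib_poly d g (Suc 0) = 1"
| "fib_poly d g (Suc (Suc n)) = d * fib_poly d g (Suc n) + g * fib_poly d g n"

definition cpoly :: "rat poly \<Rightarrow> complex \<Rightarrow> complex" where
  "cpoly p z = poly (map_poly of_rat p) z"

definition gamma_node :: "nat \<Rightarrow> nat \<Rightarrow> complex" where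
  "gamma_node n j = 2 * \<i> * complex_of_real (cos (real j * pi / real n))"

end

theory Submission
  imports Defs
begin

text \<open>
  With \<open>s\<close> a square root of \<open>g(r)\<close> and \<open>d(r) = 2 i s cos \<theta>\<close>, the recursion at \<open>r\<close> becomes
  the Chebyshev recursion scaled by powers of \<open>i s\<close>, so that
  \<open>\<F>\<^sub>n(r) sin \<theta> = (i s)\<^sup>n\<^sup>-\<^sup>1 sin (n \<theta>)\<close>. For \<open>\<theta> = j \<pi> / n\<close> with
  \<open>0 < j < n\<close> the right-hand side vanishes while \<open>sin \<theta>\<close> does not.
\<close>

lemma cpoly_0: "cpoly 0 z = 0"
  by (simp add: cpoly_def)

lemma cpoly_1: "cpoly 1 z = 1"
  by (simp add: cpoly_def map_poly_1)

lemma cpoly_add: "cpoly (p + q) z = cpoly p z + cpoly q z"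
proof -
  have "map_poly of_rat (p + q) = map_poly of_rat p + (map_poly of_rat q :: complex poly)"
    by (rule poly_eqI) (simp add: coeff_map_poly of_rat_add)
  then show ?thesis by (simp add: cpoly_def)
qed

lemma cpoly_mult: "cpoly (p * q) z = cpoly p z * cpoly q z"
proof -
  have "map_poly of_rat (p * q) = map_poly of_rat p * (map_poly of_rat q :: complex poly)"
    by (rule poly_eqI) (simp add: coeff_map_poly coeff_mult of_rat_sum of_rat_mult)
  then show ?thesis by (simp add: cpoly_def)
qed

text \<open>Adding the expansions of the sine at (n+1)t + t and (n+1)t - t cancels the cosine-sine
  products.\<close>

lemma sin_Suc_Suc_mult:
  fixes t :: real
  shows "sin (real (Suc (Suc n)) * t) = 2 * cos t * sin (real (Suc n) * t) - sin (real n * t)"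
proof -
  have "real (Suc (Suc n)) * t = real (Suc n) * t + t" "real n * t = real (Suc n) * t - t"
    by (simp_all add: algebra_simps)
  then show ?thesis by (simp only: sin_add sin_diff) simp
qed

text \<open>The closed form, multiplied by \<open>i s\<close> to avoid the exponent \<open>n - 1\<close>.\<close>

lemma cpoly_fib_poly_sin:
  fixes t :: real
  assumes d: "cpoly d r = 2 * \<i> * s * complex_of_real (cos t)" and g: "cpoly g r = s ^ 2"
  shows "\<i> * s * cpoly (fib_poly d g n) r * complex_of_real (sin t)
    = (\<i> * s) ^ n * complex_of_real (sin (real n * t))"
proof (induction n rule: induct_nat_012)
  case (ge2 n)
  define w where "w = \<i> * s"
  define c where "c = complex_of_real (cos t)"
  define F where "F k = w * cpoly (fib_poly d g k) r * complex_of_real (sin t)" for k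
  define S where "S k = complex_of_real (sin (real k * t))" for k
  \<comment> \<open>The factor i in \<open>w\<close> turns the plus sign before g in the recursion
    into the minus sign of the sine recursion.\<close>
  have "s ^ 2 = - (w ^ 2)"
    by (simp add: w_def power_mult_distrib)
  then have "F (Suc (Suc n)) = 2 * w * c * F (Suc n) - w ^ 2 * F n"
    by (simp add: F_def c_def cpoly_add cpoly_mult d g algebra_simps) (simp add: w_def algebra_simps)
  also have "\<dots> = 2 * w * c * (w ^ Suc n * S (Suc n)) - w ^ 2 * (w ^ n * S n)"
    using ge2 by (simp only: F_def w_def S_def)
  also have "\<dots> = w ^ Suc (Suc n) * (2 * c * S (Suc n) - S n)"
    by (simp add: algebra_simps power2_eq_square)
  also have "2 * c * S (Suc n) - S n = S (Suc (Suc n))"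
    by (simp only: S_def c_def sin_Suc_Suc_mult) simp
  finally show ?case by (simp only: F_def w_def S_def)
qed (simp_all add: cpoly_0 cpoly_1)

theorem theorem4p3:
  fixes d g :: "rat poly" and n :: nat and r s :: complex
  assumes "d \<noteq> 0" and "g \<noteq> 0" and "degree d > degree g"
    and "n \<ge> 2"
    and "cpoly g r \<noteq> 0"
    and "s ^ 2 = cpoly g r"
    and "\<exists>j\<in>{1..n - 1}. cpoly d r / s = gamma_node n j"
  shows "cpoly (fib_poly d g n) r = 0"
proof -
  obtain j where j: "1 \<le> j" "j < n" and dj: "cpoly d r / s = gamma_node n j"
    using assms(4,7) by auto
  define t where "t = real j * pi / real n"
  \<comment> \<open>Since x / 0 = 0 in HOL, the quotient in \<open>dj\<close> determines d(r) only
    once \<open>s\<close> is known to be nonzero.\<close>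
  have s: "s \<noteq> 0"
    using assms(5,6) by auto
  then have d: "cpoly d r = 2 * \<i> * s * complex_of_real (cos t)"
    using dj by (simp add: gamma_node_def t_def field_simps)
  have "0 < t" "t < pi"
    using j by (simp_all add: t_def field_simps)
  then have "sin t \<noteq> 0"
    using sin_gt_zero by fastforce
  \<comment> \<open>Here n t = j pi.\<close>
  moreover have "sin (real n * t) = 0"
    using j by (simp add: t_def)
  ultimately show ?thesis
    using cpoly_fib_poly_sin[OF d assms(6)[symmetric], of n] s by simp
qed

end
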